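(* Let $k,n\ge 1$ be integers, let $\mathcal{D}$ be a domain of size $k$, and let $\varepsilon_\ell>0$. The algorithm $\mathsf{att\text{-}frag}(\mathcal{R}_{k\text{-RAPPOR}})$ with parameter $\varepsilon_\ell$ (defined in the context) is a removal $\varepsilon_\ell$-differentially private local randomizer. Moreover, if $\varepsilon_\ell\in\left[1,\ \log n-\log\left(14\log\left(\frac{4}{\delta}\right)\right)\right]$ and $\delta\ge n^{-\log n}$, then $\mathsf{att\text{-}frag}(\mathcal{R}_{k\text{-RAPPOR}})$ satisfies removal $(\varepsilon_c,\delta)$-central differential privacy in the shuffle model, where $$\varepsilon_c=\sqrt{\frac{64\cdot e^{\varepsilon_\ell}\cdot\log(4/\delta)}{n}}.$$
   Context: All logarithms are natural. Algorithm $\mathsf{att\text{-}frag}(\mathcal{R}_{k\text{-RAPPOR}})$: a respondent with data $x\in\mathcal{D}$, $|\mathcal{D}|=k$, forms the one-hot encoding $\boldsymbol{x}=(x^{(1)},\dots,x^{(k)})\in\{0,1\}^k$ of $x$ (exactly one coordinate equals 1). For each $j\in[k]=\{1,\dots,k\}$, independently, it computes the bit $\mathcal{R}_j(x^{(j)},\varepsilon_\ell)$, where $\mathcal{R}_j(b,\varepsilon)$ equals $b$ with probability $e^{\varepsilon}/(1+e^{\varepsilon})$ and $1-b$ with probability $1/(1+e^{\varepsilon})$, and sends it to shuffler $\mathcal{S}_j$. The shufflers $\mathcal{S}_1,\dots,\mathcal{S}_k$ are independent. Shuffle model: with $n$ respondents holding $D=(x_1,\dots,x_n)\in\mathcal{D}^n$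 and using independent randomness, each shuffler $\mathcal{S}_j$ receives the $n$ bits $\mathcal{R}_j(x_i^{(j)},\varepsilon_\ell)$, $i\in[n]$, and outputs them in a uniformly random order (equivalently, it reveals only their sum). Central differential privacy refers to the algorithm $\mathcal{M}$ mapping $D$ to the tuple of outputs of all $k$ shufflers. Removal $\varepsilon$-DP local randomizer: $\mathcal{R}\colon\mathcal{D}\to\mathcal{S}$ such that there is a random variable $\mathcal{R}_0$ with $e^{-\varepsilon}\Pr[\mathcal{R}_0\in S]\le\Pr[\mathcal{R}(x)\in S]\le e^{\varepsilon}\Pr[\mathcal{R}_0\in S]$ for all $S\subseteq\mathcal{S}$ and all $x\in\mathcal{D}$. Removal $(\varepsilon,\delta)$-DP: a randomized algorithm $\mathcal{M}\colon\mathcal{D}^n\to\mathcal{S}$ satisfies it if there is an algorithm $\mathcal{M}'\colon\mathcal{D}^n\times 2^{[n]}\to\mathcal{S}$ such that (1) for all $D$, $\mathcal{M}'(D,[n])$ is identically distributed to $\mathcal{M}(D)$; (2) for all $D$ and $I\subseteq[n]$, $\mathcal{M}'(D,I)$ depends only on the elements of $D$ with indices in $I$; (3) for all $S\subseteq\mathcal{S}$, $D\in\mathcal{D}^n$ and $I,I'\subseteq[n]$ with $|I\bigtriangleup I'|=1$, $\Pr[\mathcal{M}'(D,I)\in S]\le e^{\varepsilon}\Pr[\mathcal{M}'(D,I')\in S]+\delta$. *)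

theory Defs
  imports "HOL-Probability.Probability" "HOL-Probability.Product_PMF"
    "HOL-Combinatorics.Permutations"
begin

text \<open>
  All output spaces below are finite, so randomized algorithms are rendered as maps into \<open>pmf\<close>.
  Elements of \<open>D\<^sup>n\<close> and \<open>k\<close>-tuples are extensional functions on \<open>{1..n}\<close> and \<open>{1..k}\<close>;
  this is why \<open>undefined\<close> is the default value in the uses of \<open>Pi_pmf\<close>.
\<close>

definition removal_dp_local_randomizer ::
  "real \<Rightarrow> 'a set \<Rightarrow> 's set \<Rightarrow> ('a \<Rightarrow> 's pmf) \<Rightarrow> bool" where
  "removal_dp_local_randomizer \<epsilon> D S R \<longleftrightarrow>
     (\<forall>x\<in>D. set_pmf (R x) \<subseteq> S) \<and>
     (\<exists>R\<^sub>0 :: 's pmf. set_pmf R\<^sub>0 \<subseteq> S \<and>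
        (\<forall>T x. T \<subseteq> S \<longrightarrow> x \<in> D \<longrightarrow>
           exp (- \<epsilon>) * measure_pmf.prob R\<^sub>0 T \<le> measure_pmf.prob (R x) T \<and>
           measure_pmf.prob (R x) T \<le> exp \<epsilon> * measure_pmf.prob R\<^sub>0 T))"

definition removal_dp ::
  "real \<Rightarrow> real \<Rightarrow> nat \<Rightarrow> 'a set \<Rightarrow> 's set \<Rightarrow> ((nat \<Rightarrow> 'a) \<Rightarrow> 's pmf) \<Rightarrow> bool" where
  "removal_dp \<epsilon> \<delta> n D S M \<longleftrightarrow>
     (\<forall>X \<in> {1..n} \<rightarrow>\<^sub>E D. set_pmf (M X) \<subseteq> S) \<and>
     (\<exists>M' :: (nat \<Rightarrow> 'a) \<Rightarrow> nat set \<Rightarrow> 's pmf.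
        (\<forall>X I. X \<in> {1..n} \<rightarrow>\<^sub>E D \<longrightarrow> I \<subseteq> {1..n} \<longrightarrow> set_pmf (M' X I) \<subseteq> S) \<and>
        (\<forall>X \<in> {1..n} \<rightarrow>\<^sub>E D. M' X {1..n} = M X) \<and>
        (\<forall>X Y I. X \<in> {1..n} \<rightarrow>\<^sub>E D \<longrightarrow> Y \<in> {1..n} \<rightarrow>\<^sub>E D \<longrightarrow> I \<subseteq> {1..n} \<longrightarrow>
           (\<forall>i\<in>I. X i = Y i) \<longrightarrow> M' X I = M' Y I) \<and>
        (\<forall>T X I I'. T \<subseteq> S \<longrightarrow> X \<in> {1..n} \<rightarrow>\<^sub>E D \<longrightarrow> I \<subseteq> {1..n} \<longrightarrow> I' \<subseteq> {1..n} \<longrightarrow>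
           card ((I - I') \<union> (I' - I)) = 1 \<longrightarrow>
           measure_pmf.prob (M' X I) T \<le> exp \<epsilon> * measure_pmf.prob (M' X I') T + \<delta>))"

definition randomized_response :: "bool \<Rightarrow> real \<Rightarrow> bool pmf" where
  "randomized_response b \<epsilon> =
     map_pmf (\<lambda>keep. if keep then b else \<not> b) (bernoulli_pmf (exp \<epsilon> / (1 + exp \<epsilon>)))"

text \<open>The enumeration \<open>enum\<close> of the domain says which element each coordinate stands for.\<close>

definition one_hot :: "(nat \<Rightarrow> 'a) \<Rightarrow> 'a \<Rightarrow> nat \<Rightarrow> bool" where
  "one_hot enum x j \<longleftrightarrow> enum j = x"

text \<open>Coordinate \<open>j\<close> of the result is the bit sent to the \<open>j\<close>-th shuffler.\<close>

definition att_frag_rappor :: "nat \<Rightarrow> (nat \<Rightarrow> 'a) \<Rightarrow> real \<Rightarrow> 'a \<Rightarrow> (nat \<Rightarrow> bool) pmf" where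
  "att_frag_rappor k enum \<epsilon> x =
     Pi_pmf {1..k} undefined (\<lambda>j. randomized_response (one_hot enum x j) \<epsilon>)"

definition shuffler :: "'b list \<Rightarrow> 'b list pmf" where
  "shuffler ys =
     map_pmf (\<lambda>\<pi>. permute_list \<pi> ys) (pmf_of_set {\<pi>. \<pi> permutes {..<length ys}})"

definition shuffle_model ::
  "nat \<Rightarrow> nat \<Rightarrow> ('a \<Rightarrow> (nat \<Rightarrow> 'b) pmf) \<Rightarrow> (nat \<Rightarrow> 'a) \<Rightarrow> (nat \<Rightarrow> 'b list) pmf" where
  "shuffle_model k n R X =
     bind_pmf (Pi_pmf {1..n} undefined (\<lambda>i. R (X i)))
       (\<lambda>Y. Pi_pmf {1..k} undefined (\<lambda>j. shuffler (map (\<lambda>i. Y i j) [1..<n+1])))"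

end

theory Submission
  imports Defs
begin

text \<open>
  Absent respondents, like the reference distribution of the local guarantee, run the randomizer
  on the all-\<open>False\<close> encoding. Presence of a respondent then affects a single shuffler, so a
  Poisson-binomial count has to be compared with its shift by one. Let every other respondent
  replace its bit, with probability \<open>2p\<close> where \<open>p = 1 / (1 + e\<^sup>\<epsilon>)\<close>, by a uniform noise bit
  (this is randomized response), and let \<open>U\<close> and \<open>V\<close> count the noise bits \<open>s\<close> and \<open>\<not> s\<close>.
  Flipping one noise bit preserves probability and shifts the count \<open>W\<close> of \<open>s\<close>, which gives the
  exact identity \<open>E[V h(W + 1, U + 1, V - 1)] = E[U h(W, U, V)]\<close>. Hence the shift costs at most a
  factor \<open>c\<close> except on \<open>U + 1 > c V\<close>, and a single exponential moment of \<open>U - c V\<close> bounds the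
  probability of that event.
\<close>

section \<open>Finite product distributions\<close>

lemma finite_set_Pi_pmf:
  assumes "finite A" "\<And>x. x \<in> A \<Longrightarrow> finite (set_pmf (p x))"
  shows "finite (set_pmf (Pi_pmf A d p))"
  using assms by (subst set_Pi_pmf) auto

lemma prob_bind_pmf:
  "measure_pmf.prob (bind_pmf M N) A = measure_pmf.expectation M (\<lambda>x. measure_pmf.prob (N x) A)"
proof -
  have "ennreal (measure_pmf.prob (bind_pmf M N) A) = emeasure (bind_pmf M N) A"
    by (simp only: measure_pmf.emeasure_eq_measure)
  also have "\<dots> = (\<integral>\<^sup>+x. ennreal (measure_pmf.prob (N x) A) \<partial>M)"
    by (simp flip: measure_pmf.emeasure_eq_measure)
  also have "\<dots> = ennreal (measure_pmf.expectation M (\<lambda>x. measure_pmf.prob (N x) A))"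
    by (intro nn_integral_eq_integral measure_pmf.integrable_const_bound[where B=1]) auto
  finally show ?thesis by (simp add: integral_nonneg_AE)
qed

lemma Pi_pmf_map_dependent:
  assumes "finite A"
  shows "Pi_pmf A d' (\<lambda>x. map_pmf (f x) (p x)) =
         map_pmf (\<lambda>h x. if x \<in> A then f x (h x) else d') (Pi_pmf A d p)"
  using assms by (simp add: map_pmf_def Pi_pmf_bind[where d' = d])

text \<open>This turns rows (respondents) into columns (shufflers): because the bits of one
  respondent are independent across coordinates, the joint output is a product over shufflers, each
  acting on its own independent column. The induction peels off one row at a time. \<open>G\<close>
  stays arbitrary since it absorbs the bit of the peeled row. The default \<open>d\<close> of the
  row product is itself a row, so column \<open>j\<close> inherits the default
  \<open>d j\<close>.\<close>

lemma Pi_pmf_transpose: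
  fixes P :: "'u \<Rightarrow> 'k \<Rightarrow> 'b pmf"
  assumes "finite U" "finite K"
  shows "bind_pmf (Pi_pmf U d (\<lambda>i. Pi_pmf K d' (P i))) (\<lambda>Y. Pi_pmf K e (\<lambda>j. G j (\<lambda>i. Y i j))) =
         Pi_pmf K e (\<lambda>j. bind_pmf (Pi_pmf U (d j) (\<lambda>i. P i j)) (G j))"
  using assms(1)
proof (induction U arbitrary: G)
  case empty
  then show ?case by (simp add: bind_return_pmf)
next
  case (insert a U)
  have upd: "(\<lambda>i. (Y(a := x)) i j) = (\<lambda>i. Y i j)(a := x j)"
      for Y :: "'u \<Rightarrow> 'k \<Rightarrow> 'b" and x j
    by auto
  have "bind_pmf (Pi_pmf (insert a U) d (\<lambda>i. Pi_pmf K d' (P i)))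
          (\<lambda>Y. Pi_pmf K e (\<lambda>j. G j (\<lambda>i. Y i j))) =
        bind_pmf (Pi_pmf K d' (P a)) (\<lambda>x. bind_pmf (Pi_pmf U d (\<lambda>i. Pi_pmf K d' (P i)))
          (\<lambda>Y. Pi_pmf K e (\<lambda>j. G j ((\<lambda>i. Y i j)(a := x j)))))"
    using insert.hyps by (simp only: Pi_pmf_insert' bind_assoc_pmf bind_return_pmf upd not_False_eq_True)
  also have "\<dots> = bind_pmf (Pi_pmf K d' (P a)) (\<lambda>x. Pi_pmf K e
          (\<lambda>j. bind_pmf (Pi_pmf U (d j) (\<lambda>i. P i j)) (\<lambda>y. G j (y(a := x j)))))"
    by (intro bind_pmf_cong refl, rule insert.IH)
  also have "\<dots> = Pi_pmf K e (\<lambda>j. bind_pmf (P a j)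
          (\<lambda>xj. bind_pmf (Pi_pmf U (d j) (\<lambda>i. P i j)) (\<lambda>y. G j (y(a := xj)))))"
    using assms(2) by (rule Pi_pmf_bind[symmetric])
  also have "\<dots> = Pi_pmf K e (\<lambda>j. bind_pmf (Pi_pmf (insert a U) (d j) (\<lambda>i. P i j)) (G j))"
    using insert.hyps
    by (simp only: Pi_pmf_insert' bind_assoc_pmf bind_return_pmf not_False_eq_True)
  finally show ?case .
qed

text \<open>Condition on all factors other than \<open>j\<close>: they have the same law on both
  sides, so the inequality for factor \<open>j\<close> can be applied to each section of
  \<open>A\<close> and averaged. The additive \<delta> is averaged over a probability measure and is
  therefore paid only once.\<close>

lemma prob_Pi_pmf_le_if_one_factor_differs:
  assumes "finite K" "j \<in> K" "\<And>i. i \<in> K \<Longrightarrow> i \<noteq> j \<Longrightarrow> P i = Q i"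
    and close: "\<And>B. measure_pmf.prob (P j) B \<le> c * measure_pmf.prob (Q j) B + \<delta>"
  shows "measure_pmf.prob (Pi_pmf K d P) A \<le> c * measure_pmf.prob (Pi_pmf K d Q) A + \<delta>"
proof -
  let ?R = "Pi_pmf (K - {j}) d Q"
  have split: "measure_pmf.prob (Pi_pmf K d F) A =
      measure_pmf.expectation ?R (\<lambda>f. measure_pmf.prob (F j) ((\<lambda>x. f(j := x)) -` A))"
    if "\<And>i. i \<in> K - {j} \<Longrightarrow> F i = Q i" for F
  proof -
    have "Pi_pmf K d F = Pi_pmf (insert j (K - {j})) d F"
      using assms(2) by (simp add: insert_absorb)
    also have "\<dots> = bind_pmf (F j) (\<lambda>x. bind_pmf (Pi_pmf (K - {j}) d F) (\<lambda>f. return_pmf (f(j := x))))"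
      using assms(1) by (intro Pi_pmf_insert') auto
    also have "Pi_pmf (K - {j}) d F = ?R"
      by (intro Pi_pmf_cong) (use that in auto)
    also have "bind_pmf (F j) (\<lambda>x. bind_pmf ?R (\<lambda>f. return_pmf (f(j := x)))) =
        bind_pmf ?R (\<lambda>f. map_pmf (\<lambda>x. f(j := x)) (F j))"
      by (subst bind_commute_pmf) (simp add: map_pmf_def)
    finally show ?thesis by (simp add: prob_bind_pmf)
  qed
  have int: "integrable ?R (\<lambda>f. measure_pmf.prob (M f) (B f))" for M :: "_ \<Rightarrow> 'b pmf" and B
    by (intro measure_pmf.integrable_const_bound[where B=1]) auto
  have "measure_pmf.prob (Pi_pmf K d P) A \<le>
      measure_pmf.expectation ?R (\<lambda>f. c * measure_pmf.prob (Q j) ((\<lambda>x. f(j := x)) -` A) + \<delta>)"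
    using assms(3) by (subst split) (auto intro!: integral_mono int close)
  also have "\<dots> = c * measure_pmf.prob (Pi_pmf K d Q) A + \<delta>"
    by (subst split) (auto simp: int)
  finally show ?thesis .
qed

section \<open>A shuffler reveals only the multiset of its inputs\<close>

lemma shuffler_cong_mset:
  assumes "mset xs = mset ys"
  shows "shuffler xs = shuffler ys"
proof -
  obtain \<rho> where \<rho>: "\<rho> permutes {..<length ys}" "permute_list \<rho> ys = xs"
    using assms by (rule mset_eq_permutation)
  have len: "length xs = length ys" using assms by (rule mset_eq_length)
  let ?S = "{\<pi>. \<pi> permutes {..<length ys}}"
  have S: "?S \<noteq> {}" "finite ?S"
    by (auto intro: permutes_id finite_permutations)
  have "shuffler xs = map_pmf (\<lambda>\<pi>. permute_list (\<rho> \<circ> \<pi>) ys) (pmf_of_set ?S)"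
    unfolding shuffler_def len
    using \<rho> S by (intro map_pmf_cong refl) (simp add: permute_list_compose set_pmf_of_set)
  also have "\<dots> = map_pmf (\<lambda>\<pi>. permute_list \<pi> ys) (map_pmf ((\<circ>) \<rho>) (pmf_of_set ?S))"
    by (simp add: pmf.map_comp o_def)
  \<comment> \<open>Composition with the fixed permutation \<rho> is a bijection of the symmetric
    group, so it preserves the uniform law.\<close>
  also have "map_pmf ((\<circ>) \<rho>) (pmf_of_set ?S) = pmf_of_set ?S"
  proof (intro map_pmf_of_set_bij_betw S)
    have "inj_on ((\<circ>) \<rho>) ?S"
      using permutes_inj[OF \<rho>(1)] by (auto intro!: inj_onI simp: fun_eq_iff inj_def)
    then show "bij_betw ((\<circ>) \<rho>) ?S ?S"
      using image_compose_permutations_left[OF \<rho>(1)]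
      by (simp add: bij_betw_def image_def setcompr_eq_image)
  qed
  finally show ?thesis by (simp add: shuffler_def)
qed

section \<open>Randomized response as a mixture of the true bit and uniform noise\<close>

lemma pmf_randomized_response:
  "pmf (randomized_response b \<epsilon>) x = (if x = b then exp \<epsilon> else 1) / (1 + exp \<epsilon>)"
proof -
  have inj: "inj (\<lambda>keep. if keep then b else \<not> b)"
    by (auto simp: inj_def)
  \<comment> \<open>Exhibits \<open>x\<close> as the image of \<open>keep = (x = b)\<close> under an
    injective map, whose \<open>pmf\<close> can then be read off.\<close>
  have x: "x = (if x = b then b else \<not> b)"
    by auto
  have pos: "0 < 1 + exp \<epsilon>" by (simp add: add_pos_pos)
  then have "0 \<le> exp \<epsilon> / (1 + exp \<epsilon>)" "exp \<epsilon> / (1 + exp \<epsilon>) \<le> 1"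
    "1 - exp \<epsilon> / (1 + exp \<epsilon>) = 1 / (1 + exp \<epsilon>)"
    by (simp_all add: diff_divide_eq_iff)
  then show ?thesis
    unfolding randomized_response_def
    by (subst x, subst pmf_map_inj'[OF inj]) auto
qed

text \<open>\<open>None\<close> means that the true bit is kept, \<open>Some r\<close> that it is
  overwritten by the noise bit \<open>r\<close>. Keeping the noise visible allows noise bits to be
  counted separately from true bits that happen to agree with them.\<close>

definition blanket :: "real \<Rightarrow> bool option pmf" where
  "blanket p = bind_pmf (bernoulli_pmf (2 * p))
     (\<lambda>noise. if noise then map_pmf Some (bernoulli_pmf (1 / 2)) else return_pmf None)"

lemma pmf_blanket:
  assumes "0 \<le> p" "p \<le> 1 / 2"
  shows "pmf (blanket p) x = (case x of Some _ \<Rightarrow> p | None \<Rightarrow> 1 - 2 * p)"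
proof -
  have "pmf (map_pmf Some (bernoulli_pmf (1 / 2))) None = 0"
    by (simp add: pmf_eq_0_set_pmf)
  then show ?thesis
    using assms
    by (cases x) (simp_all add: blanket_def pmf_bind pmf_map_inj' split: bool.split)
qed

lemma UNIV_bool_option: "(UNIV :: bool option set) = {None, Some True, Some False}"
  by (auto simp: UNIV_option_conv UNIV_bool)

lemma expectation_blanket:
  fixes f :: "bool option \<Rightarrow> real"
  assumes "0 \<le> p" "p \<le> 1 / 2"
  shows "measure_pmf.expectation (blanket p) f =
    (1 - 2 * p) * f None + p * (f (Some s) + f (Some (\<not> s)))"
  using assms
  by (subst integral_measure_pmf[of UNIV], simp_all)
     (cases s; simp add: UNIV_bool_option pmf_blanket algebra_simps)

lemma blanket_Not:
  assumes "0 \<le> p" "p \<le> 1 / 2"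
  shows "map_pmf (map_option Not) (blanket p) = blanket p"
proof (rule pmf_eqI)
  fix x :: "bool option"
  have inj: "inj (map_option Not)" by (auto intro: option.inj_map injI)
  have x: "x = map_option Not (map_option Not x)" by (cases x) auto
  show "pmf (map_pmf (map_option Not) (blanket p)) x = pmf (blanket p) x"
    by (subst x, subst pmf_map_inj'[OF inj]) (use assms in \<open>cases x; simp add: pmf_blanket\<close>)
qed

lemma flip_probability_bounds:
  fixes \<epsilon> :: real
  assumes "0 \<le> \<epsilon>"
  shows "0 \<le> 1 / (1 + exp \<epsilon>)" "1 / (1 + exp \<epsilon>) \<le> 1 / 2"
proof -
  have "2 \<le> 1 + exp \<epsilon>" using assms by simp
  then show "0 \<le> 1 / (1 + exp \<epsilon>)" "1 / (1 + exp \<epsilon>) \<le> 1 / 2"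
    using frac_le[of 1 1 2 "1 + exp \<epsilon>"] by (auto intro: divide_nonneg_nonneg)
qed

text \<open>With \<open>p = 1 / (1 + exp \<epsilon>)\<close>, the true bit comes out with
  probability \<open>(1 - 2 * p) + p\<close>, either kept or hit by noise, and the other bit with
  probability \<open>p\<close>. The condition 0 \<le> \<epsilon> makes \<open>2 * p\<close> a
  probability.\<close>

lemma randomized_response_blanket:
  assumes "0 \<le> \<epsilon>"
  shows "randomized_response b \<epsilon> = map_pmf (case_option b id) (blanket (1 / (1 + exp \<epsilon>)))"
proof (rule pmf_eqI)
  fix x
  have p: "0 \<le> 1 / (1 + exp \<epsilon>)" "1 / (1 + exp \<epsilon>) \<le> 1 / 2"
    by (rule flip_probability_bounds[OF assms])+
  have pos: "1 + exp \<epsilon> \<noteq> 0"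
    using exp_gt_zero[of \<epsilon>] by linarith
  have "case_option b id -` {x} = (if x = b then {None, Some b} else {Some x})"
  proof (rule set_eqI)
    fix y
    show "y \<in> case_option b id -` {x} \<longleftrightarrow> y \<in> (if x = b then {None, Some b} else {Some x})"
      by (cases y) auto
  qed
  moreover have "exp \<epsilon> / (1 + exp \<epsilon>) = 1 - 2 * (1 / (1 + exp \<epsilon>)) + 1 / (1 + exp \<epsilon>)"
    using pos by (simp add: divide_simps)
  ultimately show "pmf (randomized_response b \<epsilon>) x =
      pmf (map_pmf (case_option b id) (blanket (1 / (1 + exp \<epsilon>)))) x"
    by (simp add: pmf_randomized_response pmf_map measure_measure_pmf_finite pmf_blanket[OF p])
qed

section \<open>Comparing a count of randomized bits with its shift by one\<close>

lemma blanket_exchange: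
  fixes h :: "nat \<Rightarrow> nat \<Rightarrow> nat \<Rightarrow> real" and J :: "'i set" and b :: "'i \<Rightarrow> bool" and s :: bool
  assumes J: "finite J" and p: "0 \<le> p" "p \<le> 1 / 2"
  defines "Q \<equiv> Pi_pmf J None (\<lambda>_. blanket p)"
    and "N \<equiv> \<lambda>(r :: bool) T. card {i \<in> J. T i = Some r}"
    and "W \<equiv> \<lambda>T. card {i \<in> J. case_option (b i) id (T i) = s}"
  shows "measure_pmf.expectation Q
           (\<lambda>T. real (N (\<not> s) T) * h (W T + 1) (N s T + 1) (N (\<not> s) T - 1)) =
         measure_pmf.expectation Q (\<lambda>T. real (N s T) * h (W T) (N s T) (N (\<not> s) T))"
proof -
  have N_sum: "real (N r T) = (\<Sum>i\<in>J. of_bool (T i = Some r))" for r T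
    using J by (simp add: N_def Int_def)
  have fin: "finite (set_pmf Q)"
    unfolding Q_def using J by (intro finite_set_Pi_pmf) auto
  note int = integrable_measure_pmf_finite[OF fin]
  \<comment> \<open>The factors \<open>N\<close> are sums of indicators, so one index at a time
    suffices. The truncated subtraction is harmless: on the event
    \<open>T i = Some (\<not> s)\<close> the count \<open>N (\<not> s) T\<close> is at least
    1.\<close>
  have swap: "measure_pmf.expectation Q (\<lambda>T. of_bool (T i = Some s) * h (W T) (N s T) (N (\<not> s) T)) =
      measure_pmf.expectation Q
        (\<lambda>T. of_bool (T i = Some (\<not> s)) * h (W T + 1) (N s T + 1) (N (\<not> s) T - 1))"
    if i: "i \<in> J" for i
  proof -
    \<comment> \<open>The map \<sigma> flips the noise at \<open>i\<close>, if there is any, and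
      touches no other entry of \<open>J\<close>. Outside \<open>J\<close> it returns the default
      \<open>None\<close> of the product.\<close>
    define f where "f = (\<lambda>x. if x = i then map_option Not else id)"
    define \<sigma> where "\<sigma> = (\<lambda>T x. if x \<in> J then f x (T x) else None)"
    have Q: "Q = map_pmf \<sigma> Q"
    proof -
      have "Q = Pi_pmf J None (\<lambda>x. map_pmf (f x) (blanket p))"
        unfolding Q_def
      proof (rule Pi_pmf_cong)
        show "blanket p = map_pmf (f x) (blanket p)" for x
          unfolding f_def using blanket_Not[OF p] by (cases "x = i") simp_all
      qed simp_all
      then show ?thesis
        unfolding \<sigma>_def Q_def Pi_pmf_map_dependent[OF J, of None f "\<lambda>_. blanket p" None] .
    qed
    have \<sigma>i: "(\<sigma> T i = Some s) = (T i = Some (\<not> s))" for T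
      using i by (cases "T i") (auto simp: \<sigma>_def f_def)
    have counts: "W (\<sigma> T) = W T + 1 \<and> N s (\<sigma> T) = N s T + 1 \<and> N (\<not> s) (\<sigma> T) = N (\<not> s) T - 1"
      if Ti: "T i = Some (\<not> s)" for T
    proof -
      have "{x \<in> J. case_option (b x) id (\<sigma> T x) = s} =
            insert i {x \<in> J. case_option (b x) id (T x) = s}"
        "{x \<in> J. \<sigma> T x = Some s} = insert i {x \<in> J. T x = Some s}"
        "{x \<in> J. \<sigma> T x = Some (\<not> s)} = {x \<in> J. T x = Some (\<not> s)} - {i}"
        using i Ti by (auto simp: \<sigma>_def f_def split: if_splits)
      then show ?thesis
        using J i Ti by (simp add: W_def N_def card_Diff_singleton_if)
    qed
    show ?thesis
      by (subst Q, unfold integral_map_pmf, intro Bochner_Integration.integral_cong refl)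
         (auto simp: \<sigma>i counts)
  qed
  show ?thesis
    unfolding N_sum sum_distrib_right
    unfolding Bochner_Integration.integral_sum[OF int]
    by (intro sum.cong refl swap[symmetric])
qed

text \<open>Here \<open>\<phi> m\<close> plays the probability of an output event given that
  \<open>m\<close> bits equal \<open>s\<close>, \<open>c\<close> the multiplicative privacy loss,
  \<mu> the free parameter of the Chernoff bound, and the exponential term the additive
  loss.\<close>

lemma expectation_count_shift_le:
  fixes \<phi> :: "nat \<Rightarrow> real" and J :: "'i set" and b :: "'i \<Rightarrow> bool" and s :: bool and \<mu> c :: real
  assumes J: "finite J" and p: "0 \<le> p" "p \<le> 1 / 2"
    and \<phi>: "\<And>m. 0 \<le> \<phi> m" "\<And>m. \<phi> m \<le> 1" and "0 \<le> \<mu>" "0 \<le> c"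
  defines "Q \<equiv> Pi_pmf J None (\<lambda>_. blanket p)"
    and "W \<equiv> \<lambda>T. card {i \<in> J. case_option (b i) id (T i) = s}"
  shows "measure_pmf.expectation Q (\<lambda>T. \<phi> (W T + 1)) \<le>
         c * measure_pmf.expectation Q (\<lambda>T. \<phi> (W T)) +
         exp (\<mu> + real (card J) * (p * (exp \<mu> + exp (- \<mu> * c) - 2)))"
proof -
  define N where "N = (\<lambda>(r :: bool) T. card {i \<in> J. T i = Some r})"
  \<comment> \<open>Contribution of one respondent to the exponential moment of
    \<open>N s - c * N (\<not> s)\<close>; its expectation is \<open>1 + t\<close>.\<close>
  define g where "g = (\<lambda>x. exp (\<mu> * (of_bool (x = Some s) - c * of_bool (x = Some (\<not> s)))))"
  \<comment> \<open>Chosen so that both sides of the exchange identity become simple. With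
    \<open>u = N s T\<close> and \<open>v = N (\<not> s) T\<close>, the shifted side
    \<open>v * h (w + 1) (u + 1) (v - 1)\<close> equals \<open>\<phi> (w + 1)\<close> as soon as
    \<open>u + 1 \<le> c * v\<close> (which forces \<open>v > 0\<close>), while the cutoff keeps
    \<open>u * h w u v\<close> below \<open>c * \<phi> w\<close>.\<close>
  define h where "h = (\<lambda>w u v. \<phi> w * of_bool (real u \<le> c * (real v + 1)) / (real v + 1))"
  define t where "t = p * (exp \<mu> + exp (- \<mu> * c) - 2)"
  have fin: "finite (set_pmf Q)"
    unfolding Q_def using J by (intro finite_set_Pi_pmf) auto
  note int = integrable_measure_pmf_finite[OF fin]
  have N_sum: "real (N r T) = (\<Sum>i\<in>J. of_bool (T i = Some r))" for r T
    using J by (simp add: N_def Int_def)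
  have tail_eq: "exp (\<mu> * (real (N s T) + 1 - c * real (N (\<not> s) T))) = exp \<mu> * (\<Prod>i\<in>J. g (T i))" for T
  proof -
    have "(\<Prod>i\<in>J. g (T i)) = exp (\<mu> * (real (N s T) - c * real (N (\<not> s) T)))"
      unfolding g_def N_sum
      by (simp only: exp_sum[OF J, symmetric] sum_distrib_left sum_subtractf right_diff_distrib)
    then show ?thesis by (simp add: exp_add[symmetric] algebra_simps)
  qed
  have split: "\<phi> (W T + 1) \<le> real (N (\<not> s) T) * h (W T + 1) (N s T + 1) (N (\<not> s) T - 1) +
      exp \<mu> * (\<Prod>i\<in>J. g (T i))" for T
  proof (cases "real (N s T) + 1 \<le> c * real (N (\<not> s) T)")
    case True
    then have "N (\<not> s) T \<noteq> 0" by (intro notI) simp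
    then have v: "real (N (\<not> s) T - 1) + 1 = real (N (\<not> s) T)" "real (N (\<not> s) T) \<noteq> 0" by auto
    have "real (N (\<not> s) T) * h (W T + 1) (N s T + 1) (N (\<not> s) T - 1) = \<phi> (W T + 1)"
      unfolding h_def v using True v(2) by (simp add: add.commute)
    then show ?thesis by (simp flip: tail_eq)
  next
    case False
    \<comment> \<open>Off the good event the exponent is nonnegative, so the exponential alone
      dominates \<phi> \<le> 1: Markov's inequality in pointwise form.\<close>
    have "1 \<le> exp \<mu> * (\<Prod>i\<in>J. g (T i))"
      unfolding tail_eq[symmetric] using False \<open>0 \<le> \<mu>\<close> by simp
    moreover have "0 \<le> h (W T + 1) (N s T + 1) (N (\<not> s) T - 1)"
      unfolding h_def using \<phi> by simp
    ultimately show ?thesis using \<phi>(2)[of "W T + 1"] by (simp add: add_increasing)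
  qed
  have bulk: "real (N s T) * h (W T) (N s T) (N (\<not> s) T) \<le> c * \<phi> (W T)" for T
  proof (cases "real (N s T) \<le> c * (real (N (\<not> s) T) + 1)")
    case True
    then have "real (N s T) / (real (N (\<not> s) T) + 1) \<le> c"
      by (simp add: divide_le_eq)
    from mult_right_mono[OF this \<phi>(1)] show ?thesis using True by (simp add: h_def mult.commute)
  next
    case False
    then show ?thesis using \<open>0 \<le> c\<close> \<phi> by (simp add: h_def)
  qed
  have tail: "measure_pmf.expectation Q (\<lambda>T. exp \<mu> * (\<Prod>i\<in>J. g (T i))) \<le>
      exp (\<mu> + real (card J) * t)"
  proof -
    have "measure_pmf.expectation Q (\<lambda>T. \<Prod>i\<in>J. g (T i)) =
        (\<Prod>i\<in>J. measure_pmf.expectation (blanket p) g)"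
      unfolding Q_def using J
      by (intro expectation_prod_Pi_pmf integrable_measure_pmf_finite) (auto simp: g_def)
    also have "measure_pmf.expectation (blanket p) g = 1 + t"
      by (subst expectation_blanket[OF p, of _ s]) (simp add: g_def t_def algebra_simps)
    also have "(\<Prod>i\<in>J. 1 + t) \<le> exp t ^ card J"
    proof -
      \<comment> \<open>Raising \<open>1 + t \<le> exp t\<close> to a power requires
        \<open>0 \<le> 1 + t\<close>; this follows from p \<le> 1/2 and the positivity of the
        exponentials.\<close>
      have "- 1 \<le> p * (- 2)" using p by simp
      also have "\<dots> \<le> t" unfolding t_def using p by (intro mult_left_mono) auto
      finally show ?thesis by (simp add: power_mono)
    qed
    finally show ?thesis by (simp add: exp_add exp_of_nat_mult[symmetric])
  qed
  have "measure_pmf.expectation Q (\<lambda>T. \<phi> (W T + 1)) \<le>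
      measure_pmf.expectation Q (\<lambda>T. real (N (\<not> s) T) * h (W T + 1) (N s T + 1) (N (\<not> s) T - 1)) +
      measure_pmf.expectation Q (\<lambda>T. exp \<mu> * (\<Prod>i\<in>J. g (T i)))"
    unfolding Bochner_Integration.integral_add[OF int int, symmetric]
    by (intro integral_mono int split)
  also have "measure_pmf.expectation Q
      (\<lambda>T. real (N (\<not> s) T) * h (W T + 1) (N s T + 1) (N (\<not> s) T - 1)) =
      measure_pmf.expectation Q (\<lambda>T. real (N s T) * h (W T) (N s T) (N (\<not> s) T))"
    unfolding Q_def W_def N_def by (rule blanket_exchange[OF J p])
  also have "\<dots> \<le> measure_pmf.expectation Q (\<lambda>T. c * \<phi> (W T))"
    by (intro integral_mono int bulk)
  finally show ?thesis using tail by (simp add: t_def)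
qed

lemma expectation_randomized_response_count_shift_le:
  fixes \<phi> :: "nat \<Rightarrow> real" and J :: "'i set" and b :: "'i \<Rightarrow> bool" and s d :: bool and \<epsilon> \<mu> c :: real
  assumes J: "finite J" and "0 \<le> \<epsilon>"
    and \<phi>: "\<And>m. 0 \<le> \<phi> m" "\<And>m. \<phi> m \<le> 1" and "0 \<le> \<mu>" "0 \<le> c"
  defines "Q \<equiv> Pi_pmf J d (\<lambda>i. randomized_response (b i) \<epsilon>)"
    and "W \<equiv> \<lambda>y. card {i \<in> J. y i = s}"
  shows "measure_pmf.expectation Q (\<lambda>y. \<phi> (W y + 1)) \<le>
         c * measure_pmf.expectation Q (\<lambda>y. \<phi> (W y)) +
         exp (\<mu> + real (card J) * (1 / (1 + exp \<epsilon>) * (exp \<mu> + exp (- \<mu> * c) - 2)))"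
proof -
  have p: "0 \<le> 1 / (1 + exp \<epsilon>)" "1 / (1 + exp \<epsilon>) \<le> 1 / 2"
    by (rule flip_probability_bounds[OF \<open>0 \<le> \<epsilon>\<close>])+
  have Q: "Q = map_pmf (\<lambda>T i. if i \<in> J then case_option (b i) id (T i) else d)
      (Pi_pmf J None (\<lambda>_. blanket (1 / (1 + exp \<epsilon>))))"
    unfolding Q_def randomized_response_blanket[OF \<open>0 \<le> \<epsilon>\<close>]
    by (rule Pi_pmf_map_dependent[OF J])
  have W: "W (\<lambda>i. if i \<in> J then case_option (b i) id (T i) else d) =
      card {i \<in> J. case_option (b i) id (T i) = s}" for T
    unfolding W_def by (intro arg_cong[where f = card]) auto
  show ?thesis
    unfolding Q integral_map_pmf W
    by (rule expectation_count_shift_le[OF J p \<phi> \<open>0 \<le> \<mu>\<close> \<open>0 \<le> c\<close>])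
qed

section \<open>The output of a single shuffler when one input bit changes\<close>

lemma prob_randomized_response_le:
  assumes "0 \<le> \<epsilon>"
  shows "measure_pmf.prob (randomized_response b \<epsilon>) A \<le>
    exp \<epsilon> * measure_pmf.prob (randomized_response b' \<epsilon>) A"
proof -
  have pmf: "pmf (randomized_response b \<epsilon>) x \<le> exp \<epsilon> * pmf (randomized_response b' \<epsilon>) x" for x
  proof -
    have pos: "0 < 1 + exp \<epsilon>" by (simp add: add_pos_pos)
    have "1 \<le> exp \<epsilon>" using assms by simp
    then have "1 \<le> exp \<epsilon> * exp \<epsilon>" using mult_mono[of 1 "exp \<epsilon>" 1 "exp \<epsilon>"] by simp
    then have "(if x = b then exp \<epsilon> else 1) \<le> exp \<epsilon> * (if x = b' then exp \<epsilon> else 1)"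
      using \<open>1 \<le> exp \<epsilon>\<close> by auto
    from divide_right_mono[OF this less_imp_le[OF pos]]
    show ?thesis by (simp add: pmf_randomized_response)
  qed
  have "measure_pmf.prob (randomized_response b \<epsilon>) A = sum (pmf (randomized_response b \<epsilon>)) A"
    by (simp add: measure_measure_pmf_finite)
  also have "\<dots> \<le> (\<Sum>x\<in>A. exp \<epsilon> * pmf (randomized_response b' \<epsilon>) x)"
    by (intro sum_mono pmf)
  also have "\<dots> = exp \<epsilon> * measure_pmf.prob (randomized_response b' \<epsilon>) A"
    by (simp add: measure_measure_pmf_finite sum_distrib_left)
  finally show ?thesis .
qed

text \<open>Read \<open>q\<close> as the probability of answering truthfully and \<open>a\<close>,
  \<open>b\<close> as the probabilities of an event when the respondent's own output does or does
  not add to the count. The excess weight \<open>q - p\<close> is moved from \<open>a\<close> to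
  \<open>b\<close> by the assumed bound, at additive cost at most \<delta>; the remaining weights
  \<open>p\<close> are only multiplied by \<open>c\<close>, which is at least 1.\<close>

lemma randomized_response_mixture_le:
  fixes p q a b c \<delta> :: real
  assumes "0 \<le> p" "p \<le> q" "p + q = 1" "1 \<le> c" "0 \<le> \<delta>" "0 \<le> a" "0 \<le> b" "a \<le> c * b + \<delta>"
  shows "q * a + p * b \<le> c * (p * a + q * b) + \<delta>"
proof -
  have "(q - p) * a \<le> (q - p) * (c * b + \<delta>)"
    using assms by (intro mult_left_mono) auto
  moreover have "(q - p) * \<delta> \<le> 1 * \<delta>"
    using assms by (intro mult_right_mono) auto
  moreover have "1 * (p * a) \<le> c * (p * a)" "1 * (p * b) \<le> c * (p * b)"
    using assms by (intro mult_right_mono mult_nonneg_nonneg; simp)+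
  ultimately show ?thesis by (simp add: algebra_simps)
qed

text \<open>Respondent \<open>i\<close> either raises by one or leaves unchanged the count produced
  by the other \<open>n - 1\<close> respondents. The inputs \<open>b\<close> and \<open>b'\<close>
  give these two cases interchanged weights, so the shift bound for the others passes through the
  mixture inequality.\<close>

lemma prob_shuffled_bits_le:
  fixes \<epsilon> \<mu> c \<delta> :: real and b b' :: "nat \<Rightarrow> bool" and d :: bool
  assumes "i \<in> {1..n}" and bb: "\<And>l. l \<in> {1..n} \<Longrightarrow> l \<noteq> i \<Longrightarrow> b l = b' l" and "b i \<noteq> b' i"
    and \<epsilon>: "0 \<le> \<epsilon>" and \<mu>: "0 \<le> \<mu>" and c: "1 \<le> c"
    and \<delta>: "exp (\<mu> + real (n - 1) * (1 / (1 + exp \<epsilon>) * (exp \<mu> + exp (- \<mu> * c) - 2))) \<le> \<delta>"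
  defines "out \<equiv> \<lambda>b. bind_pmf (Pi_pmf {1..n} d (\<lambda>i. randomized_response (b i) \<epsilon>))
      (\<lambda>y. shuffler (map y [1..<n + 1]))"
  shows "measure_pmf.prob (out b) A \<le> c * measure_pmf.prob (out b') A + \<delta>"
proof -
  define J where "J = {1..n} - {i}"
  \<comment> \<open>Counting the value \<open>b i\<close>, rather than always \<open>True\<close>,
    puts the larger weight of \<open>b\<close> on the raised count, so that the one-sided shift
    bound covers both directions of the change.\<close>
  define s where "s = b i"
  define W where "W = (\<lambda>y. card {l \<in> J. y l = s})"
  define Q where "Q = Pi_pmf J d (\<lambda>l. randomized_response (b l) \<epsilon>)"
  \<comment> \<open>A canonical list with \<open>m\<close> entries equal to \<open>s\<close>:
    shuffling forgets the order, so every input with that count behaves the same.\<close>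
  define \<phi> where "\<phi> = (\<lambda>m. measure_pmf.prob (shuffler (replicate m s @ replicate (n - m) (\<not> s))) A)"
  have J: "finite J" "i \<notin> J" "{1..n} = insert i J" "card J = n - 1"
    using assms(1) by (auto simp: J_def)
  have count: "measure_pmf.prob (shuffler (map y [1..<n + 1])) A = \<phi> (card {l \<in> {1..n}. y l = s})" for y
  proof -
    let ?m = "card {l \<in> {1..n}. y l = s}"
    have mset: "mset (map y [1..<n + 1]) = image_mset y (mset_set {1..n})"
      by (simp only: mset_map mset_upt atLeastLessThanSuc_atLeastAtMost Suc_eq_plus1[symmetric])
    have "y -` {s} \<inter> {1..n} = {l \<in> {1..n}. y l = s}" by auto
    then have count_s: "count (mset (map y [1..<n + 1])) s = ?m"
      unfolding mset by (simp add: count_image_mset)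
    have count_not_s: "count (mset zs) (\<not> s) = length zs - count (mset zs) s" for zs
      by (induction zs) (auto simp: Suc_diff_le count_le_size[THEN order_trans])
    have "mset (map y [1..<n + 1]) = mset (replicate ?m s @ replicate (n - ?m) (\<not> s))"
    proof (rule multiset_eqI)
      fix x
      consider "x = s" | "x = (\<not> s)" by auto
      then show "count (mset (map y [1..<n + 1])) x =
          count (mset (replicate ?m s @ replicate (n - ?m) (\<not> s))) x"
      proof cases
        case 1
        then show ?thesis using count_s by simp
      next
        case 2
        then show ?thesis using count_s count_not_s[of "map y [1..<n + 1]"] by simp
      qed
    qed
    then show ?thesis unfolding \<phi>_def by (simp only: shuffler_cong_mset[of "map y [1..<n + 1]"])
  qed
  \<comment> \<open>Conditioning on the output bit of \<open>i\<close>; stated for any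
    \<open>a\<close> agreeing with \<open>b\<close> on the others, so that it serves both
    \<open>b\<close> and \<open>b'\<close>.\<close>
  have out: "measure_pmf.prob (out a) A =
      pmf (randomized_response (a i) \<epsilon>) s * measure_pmf.expectation Q (\<lambda>y. \<phi> (W y + 1)) +
      pmf (randomized_response (a i) \<epsilon>) (\<not> s) * measure_pmf.expectation Q (\<lambda>y. \<phi> (W y))"
    if a: "\<And>l. l \<in> J \<Longrightarrow> a l = b l" for a
  proof -
    have Q': "Pi_pmf J d (\<lambda>l. randomized_response (a l) \<epsilon>) = Q"
      unfolding Q_def by (intro Pi_pmf_cong) (auto simp: a)
    have "card {l \<in> {1..n}. (y(i := x)) l = s} = (if x = s then W y + 1 else W y)" for x y
    proof -
      have "{l \<in> {1..n}. (y(i := x)) l = s} =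
          (if x = s then insert i {l \<in> J. y l = s} else {l \<in> J. y l = s})"
        using J(2,3) by auto
      then show ?thesis using J(1,2) by (simp add: W_def)
    qed
    then have "measure_pmf.prob (out a) A = measure_pmf.expectation (randomized_response (a i) \<epsilon>)
        (\<lambda>x. measure_pmf.expectation Q (\<lambda>y. \<phi> (if x = s then W y + 1 else W y)))"
      unfolding out_def J(3) Pi_pmf_insert'[OF J(1,2)] Q'
      by (simp only: bind_assoc_pmf bind_return_pmf prob_bind_pmf count J(3))
    then show ?thesis
      by (subst (asm) integral_measure_pmf[of UNIV], simp_all add: UNIV_bool)
         (cases s; simp)
  qed
  have b'i: "b' i = (\<not> s)" using \<open>b i \<noteq> b' i\<close> by (auto simp: s_def)
  have \<phi>: "0 \<le> \<phi> m" "\<phi> m \<le> 1" for m by (auto simp: \<phi>_def)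
  have le: "measure_pmf.expectation Q (\<lambda>y. \<phi> (W y + 1)) \<le>
      c * measure_pmf.expectation Q (\<lambda>y. \<phi> (W y)) + \<delta>"
  proof -
    have "0 \<le> c" using c by simp
    from expectation_randomized_response_count_shift_le
        [where \<phi> = \<phi> and d = d and b = b and s = s, OF J(1) \<epsilon> \<phi> \<mu> this]
    show ?thesis using \<delta> unfolding Q_def W_def J(4) by linarith
  qed
  have pos: "0 < 1 + exp \<epsilon>" by (simp add: add_pos_pos)
  have "0 \<le> \<delta>" using \<delta> by (rule order_trans[rotated]) simp
  have "exp \<epsilon> / (1 + exp \<epsilon>) * measure_pmf.expectation Q (\<lambda>y. \<phi> (W y + 1)) +
        1 / (1 + exp \<epsilon>) * measure_pmf.expectation Q (\<lambda>y. \<phi> (W y)) \<le>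
      c * (1 / (1 + exp \<epsilon>) * measure_pmf.expectation Q (\<lambda>y. \<phi> (W y + 1)) +
        exp \<epsilon> / (1 + exp \<epsilon>) * measure_pmf.expectation Q (\<lambda>y. \<phi> (W y))) + \<delta>"
    by (rule randomized_response_mixture_le)
       (use pos \<epsilon> c le \<open>0 \<le> \<delta>\<close> \<phi> in \<open>auto simp: divide_right_mono add_divide_distrib[symmetric]\<close>)
  moreover have "measure_pmf.prob (out b) A =
      exp \<epsilon> / (1 + exp \<epsilon>) * measure_pmf.expectation Q (\<lambda>y. \<phi> (W y + 1)) +
      1 / (1 + exp \<epsilon>) * measure_pmf.expectation Q (\<lambda>y. \<phi> (W y))"
    by (subst out) (simp_all add: pmf_randomized_response s_def)
  moreover have "measure_pmf.prob (out b') A =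
      1 / (1 + exp \<epsilon>) * measure_pmf.expectation Q (\<lambda>y. \<phi> (W y + 1)) +
      exp \<epsilon> / (1 + exp \<epsilon>) * measure_pmf.expectation Q (\<lambda>y. \<phi> (W y))"
    by (subst out) (auto simp: pmf_randomized_response b'i J_def bb)
  ultimately show ?thesis by simp
qed

section \<open>Numerical estimates for the tail\<close>

lemma chernoff_exponent_le:
  fixes \<mu> :: real
  assumes "0 \<le> \<mu>" "\<mu>\<^sup>2 \<le> 1 / 14"
  shows "exp \<mu> + exp (- \<mu> * exp (8 * \<mu>)) - 2 \<le> - 2 * \<mu>\<^sup>2"
proof -
  \<comment> \<open>A lower bound for \<open>\<mu> * exp (8 * \<mu>)\<close>. In the second-order
    expansions the linear terms cancel, and what remains is at most
    \<open>\<mu>\<^sup>2 - 8 * \<mu>\<^sup>2 + 5 * \<mu>\<^sup>2\<close>.\<close>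
  define z where "z = \<mu> + 8 * \<mu>\<^sup>2"
  \<comment> \<open>A rational just above 1/sqrt 14, small enough that
    \<open>(1 + 8 * \<mu>)\<^sup>2\<close> stays below 10.\<close>
  have \<mu>: "\<mu> \<le> 27 / 100"
    by (rule power2_le_imp_le) (use assms(2) in \<open>auto simp: power2_eq_square\<close>)
  have "exp \<mu> \<le> 1 + \<mu> + \<mu>\<^sup>2"
    using assms(1) \<mu> by (intro exp_bound) auto
  moreover have "exp (- \<mu> * exp (8 * \<mu>)) \<le> 1 - z + z\<^sup>2 / 2"
  proof -
    have "0 \<le> z" using assms(1) by (simp add: z_def)
    have "\<mu> * (1 + 8 * \<mu>) \<le> \<mu> * exp (8 * \<mu>)"
      using assms(1) by (intro mult_left_mono exp_ge_add_one_self) auto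
    then have "exp (- \<mu> * exp (8 * \<mu>)) \<le> exp (- z)"
      by (simp add: z_def power2_eq_square algebra_simps)
    also have "exp (- z) = 1 / exp z" by (simp add: exp_minus field_simps)
    also have "\<dots> \<le> 1 / (1 + z + z\<^sup>2 / 2)"
      using exp_lower_Taylor_quadratic[OF \<open>0 \<le> z\<close>] \<open>0 \<le> z\<close>
      by (intro divide_left_mono) (auto intro!: add_pos_nonneg mult_pos_pos)
    also have "\<dots> \<le> 1 - z + z\<^sup>2 / 2"
    proof -
      have "(1 - z + z\<^sup>2 / 2) * (1 + z + z\<^sup>2 / 2) = 1 + z ^ 4 / 4"
        by (simp add: field_simps power2_eq_square power4_eq_xxxx)
      moreover have "0 < 1 + z + z\<^sup>2 / 2"
        using \<open>0 \<le> z\<close> by (auto intro!: add_pos_nonneg)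
      ultimately show ?thesis by (simp add: divide_le_eq)
    qed
    finally show ?thesis .
  qed
  moreover have "z\<^sup>2 / 2 \<le> 5 * \<mu>\<^sup>2"
  proof -
    have "(1 + 8 * \<mu>)\<^sup>2 \<le> 10"
    proof -
      have "(1 + 8 * \<mu>)\<^sup>2 \<le> (1 + 8 * (27 / 100))\<^sup>2"
        using assms(1) \<mu> by (intro power_mono) auto
      also have "\<dots> \<le> (10 :: real)" by (simp add: power2_eq_square)
      finally show ?thesis .
    qed
    then have "\<mu>\<^sup>2 * (1 + 8 * \<mu>)\<^sup>2 \<le> \<mu>\<^sup>2 * 10" by (intro mult_left_mono) auto
    then show ?thesis by (simp add: z_def power2_eq_square algebra_simps)
  qed
  ultimately show ?thesis by (simp add: z_def)
qed

text \<open>With \<open>L = ln (4 / \<delta>)\<close>, the upper limit on \<epsilon> says exactly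
  that \<open>\<mu>\<^sup>2\<close> is at most 1/14. Since the flip probability is at least
  \<open>1 / (2 * exp \<epsilon>)\<close>, the \<open>n - 1\<close> respondents contribute at most
  \<open>- L + L / n\<close>. The leftovers \<mu> and \<open>L / n\<close> are each at most 1/2, and
  the 4 in \<open>L\<close> pays for them because \<open>ln 4\<close> is at least 1.\<close>

lemma blanket_tail_le:
  fixes \<delta> \<epsilon> :: real
  assumes n: "n \<ge> 1" and \<delta>: "0 < \<delta>" "\<delta> < 1" and \<epsilon>: "0 < \<epsilon>" "\<epsilon> \<le> ln (real n) - ln (14 * ln (4 / \<delta>))"
  defines "\<mu> \<equiv> sqrt (exp \<epsilon> * ln (4 / \<delta>) / real n)"
  shows "exp (\<mu> + real (n - 1) * (1 / (1 + exp \<epsilon>) * (exp \<mu> + exp (- \<mu> * exp (8 * \<mu>)) - 2))) \<le> \<delta>"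
proof -
  define L where "L = ln (4 / \<delta>)"
  have n0: "0 < real n" using n by simp
  have ln4: "1 \<le> ln (4 :: real)"
    using exp_le by (intro ln_ge_iff[THEN iffD2]) auto
  have L: "L = ln 4 - ln \<delta>" using \<delta> by (simp add: L_def ln_div)
  have "ln \<delta> < 0" using \<delta> by simp
  then have "1 \<le> L" using ln4 by (simp add: L)
  have "exp \<epsilon> * (14 * L) \<le> real n"
  proof -
    have "exp \<epsilon> \<le> exp (ln (real n) - ln (14 * L))" using \<epsilon> by (simp add: L_def)
    also have "\<dots> = real n / (14 * L)" using n0 \<open>1 \<le> L\<close> by (simp add: exp_diff)
    finally show ?thesis using \<open>1 \<le> L\<close> by (simp add: pos_le_divide_eq)
  qed
  then have \<mu>14: "\<mu>\<^sup>2 \<le> 1 / 14"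
    using n0 \<open>1 \<le> L\<close> by (simp add: \<mu>_def L_def[symmetric] field_simps)
  have \<mu>2: "\<mu>\<^sup>2 = exp \<epsilon> * L / real n" using n0 \<open>1 \<le> L\<close> by (simp add: \<mu>_def L_def[symmetric])
  have \<mu>0: "0 \<le> \<mu>" using n0 \<open>1 \<le> L\<close> by (simp add: \<mu>_def L_def[symmetric])
  have \<mu>1: "\<mu> \<le> 1 / 2"
    by (rule power2_le_imp_le) (use \<mu>14 in \<open>auto simp: power2_eq_square\<close>)
  have "1 \<le> exp \<epsilon>" using \<epsilon>(1) by simp
  have p: "1 / (2 * exp \<epsilon>) \<le> 1 / (1 + exp \<epsilon>)"
    using \<open>1 \<le> exp \<epsilon>\<close> by (intro divide_left_mono) (auto intro!: mult_pos_pos add_pos_pos)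
  have "real (n - 1) * (1 / (1 + exp \<epsilon>) * (exp \<mu> + exp (- \<mu> * exp (8 * \<mu>)) - 2)) \<le>
      real (n - 1) * (1 / (1 + exp \<epsilon>) * (- 2 * \<mu>\<^sup>2))"
    by (intro mult_left_mono chernoff_exponent_le \<mu>0 \<mu>14) (auto simp: add_nonneg_nonneg)
  also have "\<dots> \<le> real (n - 1) * (1 / (2 * exp \<epsilon>) * (- 2 * \<mu>\<^sup>2))"
    by (intro mult_left_mono mult_right_mono_neg p) auto
  also have "\<dots> = - L + L / real n"
    using n n0 by (simp add: \<mu>2 of_nat_diff field_simps)
  also have "\<dots> \<le> - L + 1 / 2"
  proof -
    have "1 * (14 * L) \<le> exp \<epsilon> * (14 * L)"
      using \<open>1 \<le> exp \<epsilon>\<close> \<open>1 \<le> L\<close> by (intro mult_right_mono) auto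
    then have "2 * L \<le> real n" using \<open>exp \<epsilon> * (14 * L) \<le> real n\<close> \<open>1 \<le> L\<close> by linarith
    then show ?thesis using n0 by (simp add: field_simps)
  qed
  finally have "\<mu> + real (n - 1) * (1 / (1 + exp \<epsilon>) * (exp \<mu> + exp (- \<mu> * exp (8 * \<mu>)) - 2)) \<le>
      ln \<delta>" using \<mu>1 ln4 L by linarith
  then show ?thesis using \<delta>(1) by (simp add: ln_ge_iff)
qed

section \<open>Output spaces and the two privacy guarantees\<close>

lemma set_Pi_pmf_subset_PiE:
  assumes "finite A" "\<And>x. x \<in> A \<Longrightarrow> set_pmf (p x) \<subseteq> S"
  shows "set_pmf (Pi_pmf A undefined p) \<subseteq> A \<rightarrow>\<^sub>E S"
  using set_Pi_pmf_subset'[OF assms(1), of undefined p] assms(2)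
  by (fastforce simp: PiE_dflt_def PiE_def extensional_def)

lemma set_shuffler_subset: "set_pmf (shuffler ys) \<subseteq> {zs. length zs = length ys}"
  by (auto simp: shuffler_def)

lemma set_shuffled_tuple_subset:
  "set_pmf (bind_pmf M (\<lambda>Y. Pi_pmf {1..k} undefined (\<lambda>j :: nat. shuffler (map (\<lambda>i. Y i j) [1..<n + 1]))))
     \<subseteq> {1..k} \<rightarrow>\<^sub>E {bs. length bs = n}"
proof -
  have "set_pmf (Pi_pmf {1..k} undefined (\<lambda>j :: nat. shuffler (map (\<lambda>i. Y i j) [1..<n + 1])))
      \<subseteq> {1..k} \<rightarrow>\<^sub>E {bs. length bs = n}" for Y
    by (intro set_Pi_pmf_subset_PiE) (use set_shuffler_subset in fastforce)+
  then show ?thesis unfolding set_bind_pmf by (rule UN_least)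
qed

lemma one_hot_iff:
  assumes "bij_betw enum {1..k} D" "x \<in> D"
  obtains j where "j \<in> {1..k}" "\<And>l. l \<in> {1..k} \<Longrightarrow> one_hot enum x l \<longleftrightarrow> l = j"
proof -
  obtain j where j: "j \<in> {1..k}" "enum j = x"
    using assms by (auto simp: bij_betw_def)
  moreover have "one_hot enum x l \<longleftrightarrow> l = j" if "l \<in> {1..k}" for l
    using that j assms(1) by (auto simp: one_hot_def bij_betw_def dest: inj_onD)
  ultimately show ?thesis using that by blast
qed

text \<open>A one-hot vector differs from the all-\<open>False\<close> reference in a single
  coordinate, so the loss is one factor \<open>exp \<epsilon>\<close>; two one-hot vectors would
  differ in two.\<close>

lemma att_frag_rappor_local_dp:
  assumes enum: "bij_betw enum {1..k} D" and \<epsilon>: "0 \<le> \<epsilon>"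
  shows "removal_dp_local_randomizer \<epsilon> D ({1..k} \<rightarrow>\<^sub>E (UNIV :: bool set)) (att_frag_rappor k enum \<epsilon>)"
proof -
  define R\<^sub>0 where "R\<^sub>0 = Pi_pmf {1..k} undefined (\<lambda>_ :: nat. randomized_response False \<epsilon>)"
  have "exp (- \<epsilon>) * measure_pmf.prob R\<^sub>0 T \<le> measure_pmf.prob (att_frag_rappor k enum \<epsilon> x) T \<and>
      measure_pmf.prob (att_frag_rappor k enum \<epsilon> x) T \<le> exp \<epsilon> * measure_pmf.prob R\<^sub>0 T"
    if "x \<in> D" for x T
  proof -
    obtain j where j: "j \<in> {1..k}" "\<And>l. l \<in> {1..k} \<Longrightarrow> one_hot enum x l \<longleftrightarrow> l = j"
      using one_hot_iff[OF enum \<open>x \<in> D\<close>] by blast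
    have "measure_pmf.prob (att_frag_rappor k enum \<epsilon> x) T \<le> exp \<epsilon> * measure_pmf.prob R\<^sub>0 T + 0"
      unfolding att_frag_rappor_def R\<^sub>0_def
      by (rule prob_Pi_pmf_le_if_one_factor_differs[OF _ j(1)])
         (simp_all add: j(2) prob_randomized_response_le[OF \<epsilon>])
    moreover have "measure_pmf.prob R\<^sub>0 T \<le> exp \<epsilon> * measure_pmf.prob (att_frag_rappor k enum \<epsilon> x) T + 0"
      unfolding att_frag_rappor_def R\<^sub>0_def
      by (rule prob_Pi_pmf_le_if_one_factor_differs[OF _ j(1)])
         (simp_all add: j(2) prob_randomized_response_le[OF \<epsilon>])
    ultimately show ?thesis by (simp add: exp_minus divide_simps mult.commute)
  qed
  moreover have "set_pmf (att_frag_rappor k enum \<epsilon> x) \<subseteq> {1..k} \<rightarrow>\<^sub>E UNIV" for x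
    unfolding att_frag_rappor_def by (intro set_Pi_pmf_subset_PiE) auto
  moreover have "set_pmf R\<^sub>0 \<subseteq> {1..k} \<rightarrow>\<^sub>E UNIV"
    unfolding R\<^sub>0_def by (intro set_Pi_pmf_subset_PiE) auto
  ultimately show ?thesis
    unfolding removal_dp_local_randomizer_def by blast
qed

lemma att_frag_rappor_central_dp:
  fixes \<epsilon> \<delta> :: real and enum :: "nat \<Rightarrow> 'a"
  assumes n: "n \<ge> 1" and enum: "bij_betw enum {1..k} D" and "0 < \<delta>" "0 < \<epsilon>"
    and \<epsilon>: "\<epsilon> \<le> ln (real n) - ln (14 * ln (4 / \<delta>))"
  shows "removal_dp (sqrt (64 * exp \<epsilon> * ln (4 / \<delta>) / real n)) \<delta> n D
    ({1..k} \<rightarrow>\<^sub>E {bs :: bool list. length bs = n}) (shuffle_model k n (att_frag_rappor k enum \<epsilon>))"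
proof -
  \<comment> \<open>The encoding with absent respondents set to all \<open>False\<close>; all
    \<open>n\<close> respondents still send bits, so the shufflers' output lengths do not depend on
    \<open>I\<close>.\<close>
  define bit where "bit = (\<lambda>(X :: nat \<Rightarrow> 'a) I i j. i \<in> I \<and> one_hot enum (X i) j)"
  define tuple where "tuple = (\<lambda>Y :: nat \<Rightarrow> nat \<Rightarrow> bool.
    Pi_pmf {1..k} undefined (\<lambda>j. shuffler (map (\<lambda>i. Y i j) [1..<n + 1])))"
  define M' where "M' = (\<lambda>X I. bind_pmf
    (Pi_pmf {1..n} undefined (\<lambda>i. Pi_pmf {1..k} undefined (\<lambda>j. randomized_response (bit X I i j) \<epsilon>)))
    tuple)"
  have M'_full: "M' X {1..n} = shuffle_model k n (att_frag_rappor k enum \<epsilon>) X" for X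
    unfolding M'_def shuffle_model_def att_frag_rappor_def tuple_def bit_def
    by (intro bind_pmf_cong refl Pi_pmf_cong) auto
  have M'_local: "M' X I = M' Y I" if "\<forall>i\<in>I. X i = Y i" for X Y I
  proof -
    have "bit X I = bit Y I" using that by (auto simp: bit_def fun_eq_iff)
    then show ?thesis by (simp add: M'_def)
  qed
  have support: "set_pmf (M' X I) \<subseteq> {1..k} \<rightarrow>\<^sub>E {bs. length bs = n}" for X I
    unfolding M'_def tuple_def by (rule set_shuffled_tuple_subset)
  have dp: "measure_pmf.prob (M' X I) T \<le>
      exp (sqrt (64 * exp \<epsilon> * ln (4 / \<delta>) / real n)) * measure_pmf.prob (M' X I') T + \<delta>"
    if X: "X \<in> {1..n} \<rightarrow>\<^sub>E D" and I: "I \<subseteq> {1..n}" "I' \<subseteq> {1..n}"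
      and "card ((I - I') \<union> (I' - I)) = 1" for X I I' T
  \<comment> \<open>For \<delta> \<ge> 1 the bound is trivial; otherwise \<delta> is in the range of
    the tail estimate.\<close>
  proof (cases "\<delta> < 1")
    case False
    have "measure_pmf.prob (M' X I) T \<le> 1" by simp
    also have "1 \<le> exp (sqrt (64 * exp \<epsilon> * ln (4 / \<delta>) / real n)) * measure_pmf.prob (M' X I') T + \<delta>"
      using False by (intro add_increasing) auto
    finally show ?thesis .
  next
    case True
    \<comment> \<open>Makes the claimed central parameter equal to \<open>8 * \<mu>\<close>,
      matching the ratio \<open>exp (8 * \<mu>)\<close> of the tail estimate.\<close>
    define \<mu> where "\<mu> = sqrt (exp \<epsilon> * ln (4 / \<delta>) / real n)"
    have "0 \<le> ln (4 / \<delta>)" using True \<open>0 < \<delta>\<close> by simp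
    then have \<mu>: "0 \<le> \<mu>" by (simp add: \<mu>_def)
    have "sqrt (64 * (exp \<epsilon> * ln (4 / \<delta>) / real n)) = sqrt 64 * \<mu>"
      unfolding \<mu>_def by (rule real_sqrt_mult)
    also have "sqrt 64 = 8" by (rule real_sqrt_unique) auto
    finally have \<epsilon>c: "sqrt (64 * exp \<epsilon> * ln (4 / \<delta>) / real n) = 8 * \<mu>" by (simp add: mult.assoc)
    obtain i where i: "(I - I') \<union> (I' - I) = {i}"
      using \<open>card _ = 1\<close> by (auto simp: card_1_singleton_iff)
    then have "i \<in> {1..n}" using I by blast
    then obtain j where j: "j \<in> {1..k}" "\<And>l. l \<in> {1..k} \<Longrightarrow> one_hot enum (X i) l \<longleftrightarrow> l = j"
      using one_hot_iff[OF enum, of "X i"] X by (auto simp: PiE_iff)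
    \<comment> \<open>Needed in two ways: shufflers other than \<open>j\<close> see identical
      inputs, and inside shuffler \<open>j\<close> only respondent \<open>i\<close> changes.\<close>
    have other: "bit X I l m = bit X I' l m" if "l \<noteq> i \<or> (m \<in> {1..k} \<and> m \<noteq> j)" for l m
    proof (cases "l = i")
      case True
      then show ?thesis using that j(2) by (simp add: bit_def)
    next
      case False
      then have "l \<in> I \<longleftrightarrow> l \<in> I'" using i by blast
      then show ?thesis by (simp add: bit_def)
    qed
    have at_i: "bit X I i j \<noteq> bit X I' i j"
      using i j by (auto simp: bit_def)
    \<comment> \<open>The law of one shuffler's output. Its default is coordinate \<open>j\<close>
      of the undefined row, as transposing the product dictates.\<close>
    define out where "out = (\<lambda>I j. bind_pmf
      (Pi_pmf {1..n} ((undefined :: nat \<Rightarrow> bool) j) (\<lambda>i. randomized_response (bit X I i j) \<epsilon>))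
      (\<lambda>y. shuffler (map y [1..<n + 1])))"
    have M': "M' X I = Pi_pmf {1..k} undefined (out I)" for I
      unfolding M'_def tuple_def out_def
      by (rule Pi_pmf_transpose[where G = "\<lambda>_ y. shuffler (map y [1..<n + 1])"]) auto
    have "measure_pmf.prob (Pi_pmf {1..k} undefined (out I)) T \<le>
        exp (8 * \<mu>) * measure_pmf.prob (Pi_pmf {1..k} undefined (out I')) T + \<delta>"
    proof (rule prob_Pi_pmf_le_if_one_factor_differs[OF _ j(1)])
      show "out I m = out I' m" if "m \<in> {1..k}" "m \<noteq> j" for m
        unfolding out_def using other that by simp
      show "measure_pmf.prob (out I j) B \<le> exp (8 * \<mu>) * measure_pmf.prob (out I' j) B + \<delta>" for B
        unfolding out_def
      proof (rule prob_shuffled_bits_le[OF \<open>i \<in> {1..n}\<close>])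
        show "exp (\<mu> + real (n - 1) * (1 / (1 + exp \<epsilon>) *
            (exp \<mu> + exp (- \<mu> * exp (8 * \<mu>)) - 2))) \<le> \<delta>"
          unfolding \<mu>_def by (rule blanket_tail_le) (use assms True in auto)
      qed (use other at_i \<mu> \<open>0 < \<epsilon>\<close> in auto)
    qed simp
    then show ?thesis by (simp add: M' \<epsilon>c)
  qed
  show ?thesis
    unfolding removal_dp_def
    using M'_full M'_local support dp
    by (intro conjI ballI exI[of _ M'] allI impI) (simp_all flip: M'_full)
qed

theorem mainTheorem1:
  fixes k n :: nat and D :: "'a set" and enum :: "nat \<Rightarrow> 'a" and \<epsilon>\<^sub>l :: real
  assumes "k \<ge> 1" and "n \<ge> 1"
    and "finite D" and "card D = k" and "bij_betw enum {1..k} D"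
    and "\<epsilon>\<^sub>l > 0"
  shows "removal_dp_local_randomizer \<epsilon>\<^sub>l D ({1..k} \<rightarrow>\<^sub>E (UNIV :: bool set))
           (att_frag_rappor k enum \<epsilon>\<^sub>l) \<and>
         (\<forall>\<delta> :: real.
            \<epsilon>\<^sub>l \<in> {1 .. ln (real n) - ln (14 * ln (4 / \<delta>))} \<longrightarrow>
            \<delta> \<ge> real n powr (- ln (real n)) \<longrightarrow>
            removal_dp (sqrt (64 * exp \<epsilon>\<^sub>l * ln (4 / \<delta>) / real n)) \<delta> n D
              ({1..k} \<rightarrow>\<^sub>E {bs :: bool list. length bs = n})
              (shuffle_model k n (att_frag_rappor k enum \<epsilon>\<^sub>l)))"
proof (intro conjI allI impI)
  show "removal_dp_local_randomizer \<epsilon>\<^sub>l D ({1..k} \<rightarrow>\<^sub>E (UNIV :: bool set)) (att_frag_rappor k enum \<epsilon>\<^sub>l)"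
    using assms by (intro att_frag_rappor_local_dp) auto
next
  fix \<delta> :: real
  assume \<epsilon>: "\<epsilon>\<^sub>l \<in> {1 .. ln (real n) - ln (14 * ln (4 / \<delta>))}" and \<delta>: "\<delta> \<ge> real n powr (- ln (real n))"
  have "0 < real n powr (- ln (real n))" using \<open>n \<ge> 1\<close> by simp
  then have "0 < \<delta>" using \<delta> by (rule less_le_trans)
  then show "removal_dp (sqrt (64 * exp \<epsilon>\<^sub>l * ln (4 / \<delta>) / real n)) \<delta> n D
      ({1..k} \<rightarrow>\<^sub>E {bs :: bool list. length bs = n}) (shuffle_model k n (att_frag_rappor k enum \<epsilon>\<^sub>l))"
    using assms \<epsilon> by (intro att_frag_rappor_central_dp) auto
qed

end
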